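(* In the setting described in the context, the $r\times n_1^o$ matrix $K=A_{12}^*P_0$ is of full column rank, and $r\ge n_1^o$. Moreover, the $n_1^o\times n_1^o$ matrix $K^*S^{-1}K=P_0^*A_{12}S^{-1}A_{12}^*P_0$ is symmetric negative definite.
   Context: Superscript $*$ denotes transpose. $A_1=\begin{pmatrix}A_{11}&A_{12}\\ A_{12}^*&A_{22}\end{pmatrix}$ is a real symmetric invertible $n\times n$ matrix, with $A_{11}$ of size $(n-r)\times(n-r)$ and $A_{22}$ of size $r\times r$. The symmetric matrix $A_{11}$ is singular, and $n_1^o\ge1$ is the multiplicity of its eigenvalue $0$. $S$ is a real symmetric negative definite $r\times r$ matrix. The real matrices $P_1$ of size $(n-r)\times(n-r-n_1^o)$ and $P_0$ of size $(n-r)\times n_1^o$ are such that $(P_1,P_0)$ is orthogonal and $(P_1,P_0)^*A_{11}(P_1,P_0)=\mathrm{diag}(\Lambda_1,0)$ with $\Lambda_1$ an invertible diagonal matrix. *)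

theory Defs
  imports
    "Jordan_Normal_Form.Char_Poly"
    "Jordan_Normal_Form.DL_Rank"
    "Jordan_Normal_Form.Gauss_Jordan_Elimination"
begin

definition symmetric_mat :: "'a mat \<Rightarrow> bool" where
  "symmetric_mat A \<longleftrightarrow> A\<^sup>T = A"

definition negative_definite_mat :: "real mat \<Rightarrow> bool" where
  "negative_definite_mat A \<longleftrightarrow> square_mat A \<and>
     (\<forall>x \<in> carrier_vec (dim_row A). x \<noteq> 0\<^sub>v (dim_row A) \<longrightarrow> x \<bullet> (A *\<^sub>v x) < 0)"

(* The library's orthogonal_mat only asks the columns to be pairwise orthogonal and nonzero;
   here the columns are orthonormal. *)
definition real_orthogonal_mat :: "real mat \<Rightarrow> bool" where
  "real_orthogonal_mat Q \<longleftrightarrow> square_mat Q \<and> inverts_mat Q\<^sup>T Q \<and> inverts_mat Q Q\<^sup>T"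

definition append_cols_mat :: "'a mat \<Rightarrow> 'a mat \<Rightarrow> 'a mat" where
  "append_cols_mat A B = mat_of_cols (dim_row A) (cols A @ cols B)"

definition full_column_rank :: "real mat \<Rightarrow> bool" where
  "full_column_rank A \<longleftrightarrow> vec_space.rank (dim_row A) A = dim_col A"

(* mat_inverse returns an option; the value is the inverse exactly when the matrix is invertible
   and is unspecified otherwise. *)
definition inv_mat :: "real mat \<Rightarrow> real mat" where
  "inv_mat A = the (mat_inverse A)"

end

theory Submission
  imports Defs
begin

text \<open>
  If \<open>K x = 0\<close>, then \<open>y = P\<^sub>0 x\<close> satisfies \<open>A\<^sub>1\<^sub>1 y = 0\<close> and \<open>A\<^sub>1\<^sub>2\<^sup>* y = 0\<close>, so \<open>(y, 0)\<close> lies in the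
  kernel of the invertible matrix \<open>A\<^sub>1\<close>; hence \<open>y = 0\<close>, and \<open>x = 0\<close> since the columns of \<open>P\<^sub>0\<close> are
  orthonormal. Definiteness then follows because congruence by an injective matrix preserves it and
  \<open>z \<bullet> S\<^sup>-\<^sup>1 z = y \<bullet> S y\<close> for \<open>z = S y\<close>.
\<close>

lemma mult_mat_zero_vec [simp]:
  fixes A :: "'a::semiring_0 mat"
  assumes "A \<in> carrier_mat m n"
  shows "A *\<^sub>v 0\<^sub>v n = 0\<^sub>v m"
  using assms by (intro eq_vecI) auto

lemma dim_append_cols_mat [simp]:
  "dim_row (append_cols_mat A B) = dim_row A"
  "dim_col (append_cols_mat A B) = dim_col A + dim_col B"
  by (simp_all add: append_cols_mat_def)

text \<open>Row \<open>i\<close> of the concatenation is row \<open>i\<close> of \<open>A\<close>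
  followed by row \<open>i\<close> of \<open>B\<close>, so every scalar product splits in two. This
  block rule lets \<open>P0\<close> be reached through the orthogonal matrix built from
  \<open>P1\<close> and \<open>P0\<close>.\<close>

lemma append_cols_mat_mult_vec:
  fixes A B :: "'a::comm_semiring_0 mat"
  assumes A: "A \<in> carrier_mat m k" and B: "B \<in> carrier_mat m l"
    and u: "u \<in> carrier_vec k" and v: "v \<in> carrier_vec l"
  shows "append_cols_mat A B *\<^sub>v (u @\<^sub>v v) = A *\<^sub>v u + B *\<^sub>v v"
proof (rule eq_vecI)
  fix i assume "i < dim_vec (A *\<^sub>v u + B *\<^sub>v v)"
  then have i: "i < m" using B by simp
  have "row (append_cols_mat A B) i = row A i @\<^sub>v row B i"
    using A B i
    by (intro eq_vecI) (auto simp: append_cols_mat_def mat_of_cols_index nth_append)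
  then show "(append_cols_mat A B *\<^sub>v (u @\<^sub>v v)) $ i = (A *\<^sub>v u + B *\<^sub>v v) $ i"
    using A B u v i by (simp add: scalar_prod_append[of _ k _ l])
qed (use A B in simp)

lemma invertible_mat_mult_vec_eq_0D:
  fixes A :: "'a::comm_semiring_1 mat"
  assumes "invertible_mat A" and A: "A \<in> carrier_mat n n" and x: "x \<in> carrier_vec n"
    and "A *\<^sub>v x = 0\<^sub>v n"
  shows "x = 0\<^sub>v n"
proof -
  obtain B where AB: "A * B = 1\<^sub>m n" and BA: "B * A = 1\<^sub>m (dim_row B)"
    using assms(1) A by (auto simp: invertible_mat_def inverts_mat_def)
  \<comment> \<open>Invertibility gives \<open>B\<close> without a shape; both dimensions are
    recovered by comparing column counts in the two identities.\<close>
  have "dim_col B = n" using arg_cong[OF AB, of dim_col] by simp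
  moreover have "dim_row B = n" using arg_cong[OF BA, of dim_col] A by simp
  ultimately have B: "B \<in> carrier_mat n n" by auto
  have "x = (B * A) *\<^sub>v x" using BA B x by simp
  also have "\<dots> = B *\<^sub>v (A *\<^sub>v x)" using A B x by simp
  also have "\<dots> = 0\<^sub>v n" using assms(4) B by simp
  finally show ?thesis .
qed

text \<open>Linear independence is a property of the set of columns, which would hide a repeated
  column. Distinctness is therefore derived first; both facts come from the trivial kernel.\<close>

lemma full_column_rankI:
  assumes A: "A \<in> carrier_mat m k"
    and inj: "\<And>x. x \<in> carrier_vec k \<Longrightarrow> A *\<^sub>v x = 0\<^sub>v m \<Longrightarrow> x = 0\<^sub>v k"
  shows "full_column_rank A"
proof -
  interpret vec_space "TYPE(real)" m .
  have dist: "distinct (cols A)"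
    unfolding distinct_conv_nth
  proof (intro allI impI notI)
    fix i j assume "i < length (cols A)" "j < length (cols A)" and ij: "i \<noteq> j"
      and eq: "cols A ! i = cols A ! j"
    then have i: "i < k" and j: "j < k" using A by auto
    \<comment> \<open>Applying \<open>A\<close> to this vector gives column \<open>i\<close> minus
      column \<open>j\<close>, so equal columns would put a nonzero vector into the kernel.\<close>
    let ?x = "unit_vec k i - unit_vec k j :: real vec"
    have "A *\<^sub>v ?x = A *\<^sub>v unit_vec k i - A *\<^sub>v unit_vec k j"
      using A by (intro mult_minus_distrib_mat_vec) auto
    also have "\<dots> = col A i - col A j"
      using A i j by (intro arg_cong2[where f = "(-)"] eq_vecI) auto
    also have "\<dots> = 0\<^sub>v m" using eq A i j by auto
    finally have "?x = 0\<^sub>v k" by (intro inj) auto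
    then have "?x $ i = 0" using i by simp
    then show False using i j ij by simp
  qed
  \<comment> \<open>The coefficients of a linear dependence among the distinct columns would form a
    nonzero kernel vector.\<close>
  have "lin_indpt (set (cols A))"
    using lin_depE[OF A _ dist] inj by metis
  then show ?thesis
    using lin_indpt_full_rank[OF A dist] A by (simp add: full_column_rank_def)
qed

text \<open>The rank is the dimension of the column span, a subspace of a space whose dimension is
  the number of rows.\<close>

lemma full_column_rank_imp_le:
  assumes "full_column_rank A"
  shows "dim_col A \<le> dim_row A"
proof -
  interpret vec_space "TYPE(real)" "dim_row A" .
  have "set (cols A) \<subseteq> carrier V" using cols_dim[of A] by simp
  then have "rank A \<le> dim"
    unfolding rank_def
    by (intro subspace_dim span_is_subspace fin_dim fin_dim_span) auto
  then show ?thesis using assms by (simp add: full_column_rank_def dim_is_n)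
qed

text \<open>A nonzero kernel vector \<open>v\<close> of \<open>S\<close> would make
  \<open>v \<bullet> (S *\<^sub>v v)\<close> vanish instead of being negative, so the determinant is
  nonzero. Only then does \<open>inv_mat\<close> denote a genuine inverse.\<close>

lemma negative_definite_mat_inverse:
  assumes S: "S \<in> carrier_mat n n" and neg: "negative_definite_mat S"
  shows "inv_mat S \<in> carrier_mat n n" "S * inv_mat S = 1\<^sub>m n" "inv_mat S * S = 1\<^sub>m n"
proof -
  have "det S \<noteq> 0"
  proof
    assume "det S = 0"
    then obtain v where v: "v \<in> carrier_vec n" "v \<noteq> 0\<^sub>v n" "S *\<^sub>v v = 0\<^sub>v n"
      using det_0_iff_vec_prod_zero_field[OF S] by blast
    then have "v \<bullet> (S *\<^sub>v v) < 0"
      using neg S by (auto simp: negative_definite_mat_def)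
    with v show False by simp
  qed
  then have "S \<in> Units (ring_mat TYPE(real) n ())"
    by (rule det_non_zero_imp_unit[OF S])
  then obtain B where "mat_inverse S = Some B"
    using mat_inverse(1)[OF S] by fastforce
  then show "inv_mat S \<in> carrier_mat n n" "S * inv_mat S = 1\<^sub>m n" "inv_mat S * S = 1\<^sub>m n"
    using mat_inverse(2)[OF S] by (auto simp: inv_mat_def)
qed

text \<open>Transposing \<open>S * T = 1\<^sub>m n\<close> shows that \<open>T\<^sup>T\<close> is a
  left inverse of \<open>S\<close>; a left inverse equals a right inverse.\<close>

lemma symmetric_mat_inverse:
  fixes S :: "'a::comm_semiring_1 mat"
  assumes S: "S \<in> carrier_mat n n" and T: "T \<in> carrier_mat n n"
    and sym: "symmetric_mat S" and ST: "S * T = 1\<^sub>m n" and TS: "T * S = 1\<^sub>m n"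
  shows "symmetric_mat T"
proof -
  have "T\<^sup>T * S = 1\<^sub>m n"
    using transpose_mult[OF S T] ST sym by (simp add: symmetric_mat_def)
  then have "T = (T\<^sup>T * S) * T" using T by simp
  also have "\<dots> = T\<^sup>T * (S * T)"
    using S T by (intro assoc_mult_mat) auto
  also have "\<dots> = T\<^sup>T" using ST T by simp
  finally show ?thesis by (simp add: symmetric_mat_def)
qed

lemma negative_definite_inv_mat:
  assumes S: "S \<in> carrier_mat n n" and neg: "negative_definite_mat S"
  shows "negative_definite_mat (inv_mat S)"
  unfolding negative_definite_mat_def
proof (intro conjI ballI impI)
  note T = negative_definite_mat_inverse[OF assms]
  show "square_mat (inv_mat S)" using T by simp
  fix z :: "real vec" assume "z \<in> carrier_vec (dim_row (inv_mat S))" "z \<noteq> 0\<^sub>v (dim_row (inv_mat S))"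
  then have z: "z \<in> carrier_vec n" and z0: "z \<noteq> 0\<^sub>v n" using T(1) by auto
  define y where "y = inv_mat S *\<^sub>v z"
  have y: "y \<in> carrier_vec n" using T z by (simp add: y_def)
  have "S *\<^sub>v y = (S * inv_mat S) *\<^sub>v z" using S T(1) z by (simp add: y_def)
  then have Sy: "S *\<^sub>v y = z" using T z by simp
  with z0 S have "y \<noteq> 0\<^sub>v n" by auto
  with neg y S have "y \<bullet> (S *\<^sub>v y) < 0" by (auto simp: negative_definite_mat_def)
  then show "z \<bullet> (inv_mat S *\<^sub>v z) < 0"
    using Sy z y by (simp add: comm_scalar_prod[of _ n] flip: y_def)
qed

lemma symmetric_mat_congruence:
  fixes T K :: "'a::comm_semiring_0 mat"
  assumes K: "K \<in> carrier_mat r k" and T: "T \<in> carrier_mat r r" and sym: "symmetric_mat T"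
  shows "symmetric_mat (K\<^sup>T * T * K)"
proof -
  have "(K\<^sup>T * T * K)\<^sup>T = K\<^sup>T * (K\<^sup>T * T)\<^sup>T"
    using K T by (intro transpose_mult) auto
  also have "(K\<^sup>T * T)\<^sup>T = T * K"
    using transpose_mult[of "K\<^sup>T" k r T r] K T sym by (simp add: symmetric_mat_def)
  also have "K\<^sup>T * (T * K) = K\<^sup>T * T * K"
    using K T by (intro assoc_mult_mat[symmetric]) auto
  finally show ?thesis by (simp add: symmetric_mat_def)
qed

text \<open>Moving \<open>K\<^sup>T\<close> across the scalar product turns the form at
  \<open>x\<close> into the form of \<open>T\<close> at \<open>K *\<^sub>v x\<close>, which is
  nonzero when \<open>x\<close> is.\<close>

lemma negative_definite_mat_congruence:
  assumes K: "K \<in> carrier_mat r k" and T: "T \<in> carrier_mat r r" and neg: "negative_definite_mat T"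
    and inj: "\<And>x. x \<in> carrier_vec k \<Longrightarrow> K *\<^sub>v x = 0\<^sub>v r \<Longrightarrow> x = 0\<^sub>v k"
  shows "negative_definite_mat (K\<^sup>T * T * K)"
  unfolding negative_definite_mat_def
proof (intro conjI ballI impI)
  show "square_mat (K\<^sup>T * T * K)" using K by simp
  fix x :: "real vec" assume "x \<in> carrier_vec (dim_row (K\<^sup>T * T * K))" "x \<noteq> 0\<^sub>v (dim_row (K\<^sup>T * T * K))"
  then have x: "x \<in> carrier_vec k" and x0: "x \<noteq> 0\<^sub>v k" using K by auto
  have Kx: "K *\<^sub>v x \<in> carrier_vec r" using K x by simp
  have "(K\<^sup>T * T * K) *\<^sub>v x = (K\<^sup>T * T) *\<^sub>v (K *\<^sub>v x)"
    using K T x by (intro assoc_mult_mat_vec) auto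
  also have "\<dots> = K\<^sup>T *\<^sub>v (T *\<^sub>v (K *\<^sub>v x))"
    using K T Kx by (intro assoc_mult_mat_vec) auto
  finally have "x \<bullet> ((K\<^sup>T * T * K) *\<^sub>v x) = (K\<^sup>T *\<^sub>v (T *\<^sub>v (K *\<^sub>v x))) \<bullet> x"
    using K T x by (simp add: comm_scalar_prod[of _ k])
  also have "\<dots> = (T *\<^sub>v (K *\<^sub>v x)) \<bullet> (K *\<^sub>v x)"
    using K T x by (intro transpose_vec_mult_scalar) auto
  also have "\<dots> = (K *\<^sub>v x) \<bullet> (T *\<^sub>v (K *\<^sub>v x))"
    using K T x by (intro comm_scalar_prod[of _ r]) auto
  also have "\<dots> < 0"
    using neg T Kx inj[OF x] x0 by (auto simp: negative_definite_mat_def)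
  finally show "x \<bullet> ((K\<^sup>T * T * K) *\<^sub>v x) < 0" .
qed

theorem proposition3p2:
  fixes n r n1o :: nat
    and A1 A11 A12 A22 S P1 P0 \<Lambda>1 K :: "real mat"
  assumes "r \<le> n"
    and "A11 \<in> carrier_mat (n - r) (n - r)"
    and "A12 \<in> carrier_mat (n - r) r"
    and "A22 \<in> carrier_mat r r"
    and "A1 = four_block_mat A11 A12 A12\<^sup>T A22"
    and "symmetric_mat A1"
    and "invertible_mat A1"
    and "\<not> invertible_mat A11"
    and "n1o = Polynomial.order 0 (char_poly A11)"
    and "n1o \<ge> 1"
    and "S \<in> carrier_mat r r"
    and "symmetric_mat S"
    and "negative_definite_mat S"
    and "P1 \<in> carrier_mat (n - r) (n - r - n1o)"
    and "P0 \<in> carrier_mat (n - r) n1o"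
    and "real_orthogonal_mat (append_cols_mat P1 P0)"
    and "\<Lambda>1 \<in> carrier_mat (n - r - n1o) (n - r - n1o)"
    and "diagonal_mat \<Lambda>1"
    and "invertible_mat \<Lambda>1"
    and "(append_cols_mat P1 P0)\<^sup>T * A11 * append_cols_mat P1 P0
           = diag_block_mat [\<Lambda>1, 0\<^sub>m n1o n1o]"
    and "K = A12\<^sup>T * P0"
  shows "K \<in> carrier_mat r n1o \<and>
    full_column_rank K \<and>
    r \<ge> n1o \<and>
    K\<^sup>T * inv_mat S * K \<in> carrier_mat n1o n1o \<and>
    K\<^sup>T * inv_mat S * K = P0\<^sup>T * A12 * inv_mat S * A12\<^sup>T * P0 \<and>
    symmetric_mat (K\<^sup>T * inv_mat S * K) \<and>
    negative_definite_mat (K\<^sup>T * inv_mat S * K)"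
proof -
  note A11 = assms(2) and A12 = assms(3) and A22 = assms(4) and S = assms(11)
    and P1 = assms(14) and P0 = assms(15) and L = assms(17)
  define m P where "m = n - r" and "P = append_cols_mat P1 P0"
  have "square_mat P" "P\<^sup>T * P = 1\<^sub>m (dim_col P)" "P * P\<^sup>T = 1\<^sub>m (dim_row P)"
    using assms(16) by (auto simp: real_orthogonal_mat_def inverts_mat_def P_def)
  moreover have "dim_row P = m" using P1 by (simp add: P_def m_def)
  ultimately have P: "P \<in> carrier_mat m m" and PTP: "P\<^sup>T * P = 1\<^sub>m m" and PPT: "P * P\<^sup>T = 1\<^sub>m m"
    by auto
  \<comment> \<open>Natural subtraction truncates, so this says \<open>n1o\<close> \<le>
    \<open>m\<close>. It holds because the square matrix \<open>P\<close> has \<open>m - n1o\<close>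
    columns from \<open>P1\<close> and \<open>n1o\<close> from \<open>P0\<close>.\<close>
  have m: "m - n1o + n1o = m"
    using P P1 P0 unfolding P_def m_def by (metis carrier_matD(2) dim_append_cols_mat(2))
  have A11: "A11 \<in> carrier_mat m m" and A12: "A12 \<in> carrier_mat m r"
    and P0: "P0 \<in> carrier_mat m n1o"
    using A11 A12 P0 by (simp_all add: m_def)
  have K: "K \<in> carrier_mat r n1o" using assms(21) A12 P0 by simp
  have A1: "A1 \<in> carrier_mat (m + r) (m + r)" using assms(5) A11 A22 by simp

  \<comment> \<open>The trivial kernel of \<open>K\<close> serves twice below: for the rank and for
    the definiteness of the congruence.\<close>
  have inj: "x = 0\<^sub>v n1o" if x: "x \<in> carrier_vec n1o" and Kx: "K *\<^sub>v x = 0\<^sub>v r" for x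
  proof -
    \<comment> \<open>These are the coordinates of \<open>P0 *\<^sub>v x\<close> in the orthonormal
      basis given by the columns of \<open>P\<close>: zero along \<open>P1\<close>, and
      \<open>x\<close> along \<open>P0\<close>.\<close>
    let ?w = "0\<^sub>v (m - n1o) @\<^sub>v x"
    define y where "y = P0 *\<^sub>v x"
    have y: "y \<in> carrier_vec m" using P0 x by (simp add: y_def)
    have w: "?w \<in> carrier_vec m" using x m by (metis append_carrier_vec zero_carrier_vec)
    have Pw: "P *\<^sub>v ?w = y"
      using append_cols_mat_mult_vec[OF P1 assms(15) zero_carrier_vec x] P1 y
      by (simp add: P_def y_def m_def)
    have "(P\<^sup>T * A11 * P) *\<^sub>v ?w = (P\<^sup>T * A11) *\<^sub>v y"
      using P A11 w unfolding Pw[symmetric] by (intro assoc_mult_mat_vec) auto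
    also have "\<dots> = P\<^sup>T *\<^sub>v (A11 *\<^sub>v y)"
      using P A11 y by (intro assoc_mult_mat_vec) auto
    finally have "(P\<^sup>T * A11 * P) *\<^sub>v ?w = P\<^sup>T *\<^sub>v (A11 *\<^sub>v y)" .
    \<comment> \<open>In the diagonalized form, \<open>\<Lambda>1\<close> acts on the zero part of
      \<open>?w\<close> and the zero block acts on \<open>x\<close>.\<close>
    moreover have "(P\<^sup>T * A11 * P) *\<^sub>v ?w = 0\<^sub>v m"
    proof -
      have "P\<^sup>T * A11 * P = four_block_mat \<Lambda>1 (0\<^sub>m (m - n1o) n1o) (0\<^sub>m n1o (m - n1o)) (0\<^sub>m n1o n1o)"
        using assms(20) L by (simp add: P_def m_def)
      then have "(P\<^sup>T * A11 * P) *\<^sub>v ?w = \<Lambda>1 *\<^sub>v 0\<^sub>v (m - n1o) @\<^sub>v 0\<^sub>m n1o n1o *\<^sub>v x"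
        using mult_mat_vec_split[of \<Lambda>1 "m - n1o" "0\<^sub>m n1o n1o" n1o "0\<^sub>v (m - n1o)" x] L x
        by (simp add: m_def)
      also have "\<dots> = 0\<^sub>v (m - n1o) @\<^sub>v 0\<^sub>v n1o"
      proof -
        have "\<Lambda>1 *\<^sub>v 0\<^sub>v (m - n1o) = 0\<^sub>v (m - n1o)" using L by (simp add: m_def)
        moreover have "0\<^sub>m n1o n1o *\<^sub>v x = 0\<^sub>v n1o" using x by (intro eq_vecI) auto
        ultimately show ?thesis by simp
      qed
      also have "\<dots> = 0\<^sub>v (m - n1o + n1o)" by (intro eq_vecI) auto
      finally show ?thesis by (simp only: m)
    qed
    ultimately have PAy: "P\<^sup>T *\<^sub>v (A11 *\<^sub>v y) = 0\<^sub>v m" by simp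
    \<comment> \<open>Inserting \<open>P * P\<^sup>T\<close> cancels the factor
      \<open>P\<^sup>T\<close>, so that \<open>y\<close> itself lies in the kernel of
      \<open>A11\<close>.\<close>
    have "A11 *\<^sub>v y = (P * P\<^sup>T) *\<^sub>v (A11 *\<^sub>v y)" using PPT A11 y by simp
    also have "\<dots> = P *\<^sub>v (P\<^sup>T *\<^sub>v (A11 *\<^sub>v y))"
      using P A11 y by (intro assoc_mult_mat_vec) auto
    finally have A11y: "A11 *\<^sub>v y = 0\<^sub>v m" using PAy P by simp
    have "A12\<^sup>T *\<^sub>v y = K *\<^sub>v x"
      using assms(21) A12 P0 x by (simp add: y_def assoc_mult_mat_vec[of _ r m])
    \<comment> \<open>The upper block row yields \<open>A11 *\<^sub>v y\<close>, the lower one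
      \<open>A12\<^sup>T *\<^sub>v y\<close>, which is \<open>K *\<^sub>v x\<close>; the zero lower
      part of the vector removes \<open>A12\<close> and \<open>A22\<close>.\<close>
    then have "A1 *\<^sub>v (y @\<^sub>v 0\<^sub>v r) = 0\<^sub>v m @\<^sub>v 0\<^sub>v r"
      using four_block_mat_mult_vec[OF A11 A12 _ A22 y zero_carrier_vec, of "A12\<^sup>T"]
        assms(5) A11y Kx A12 A22 by simp
    also have "\<dots> = 0\<^sub>v (m + r)" by (intro eq_vecI) auto
    finally have "y @\<^sub>v 0\<^sub>v r = 0\<^sub>v (m + r)"
      using y invertible_mat_mult_vec_eq_0D[OF assms(7) A1, of "y @\<^sub>v 0\<^sub>v r"] by simp
    also have "\<dots> = 0\<^sub>v m @\<^sub>v 0\<^sub>v r" by (intro eq_vecI) auto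
    finally have y0: "y = 0\<^sub>v m" using y append_vec_eq[of y m "0\<^sub>v m"] by simp
    \<comment> \<open>Since \<open>P\<^sup>T\<close> undoes \<open>P\<close>, the coordinate vector
      \<open>?w\<close> vanishes with \<open>y\<close>, and \<open>x\<close> is its lower
      part.\<close>
    have "?w = (P\<^sup>T * P) *\<^sub>v ?w" using PTP w by simp
    also have "\<dots> = P\<^sup>T *\<^sub>v y" using P w Pw by (simp add: assoc_mult_mat_vec[of _ m m])
    also have "\<dots> = 0\<^sub>v (m - n1o + n1o)" using y0 P m by simp
    also have "\<dots> = 0\<^sub>v (m - n1o) @\<^sub>v 0\<^sub>v n1o" by (intro eq_vecI) auto
    finally show ?thesis
      using append_vec_eq[OF zero_carrier_vec zero_carrier_vec, of "m - n1o" x "0\<^sub>v n1o"] by blast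
  qed

  note T = negative_definite_mat_inverse[OF S assms(13)]
  have rank: "full_column_rank K" by (rule full_column_rankI[OF K inj])
  have "K\<^sup>T = P0\<^sup>T * A12" using assms(21) transpose_mult[of "A12\<^sup>T" r m P0 n1o] A12 P0 by simp
  moreover have "P0\<^sup>T * A12 * inv_mat S * (A12\<^sup>T * P0) = P0\<^sup>T * A12 * inv_mat S * A12\<^sup>T * P0"
    using A12 P0 T(1) by (intro assoc_mult_mat[symmetric]) auto
  ultimately have "K\<^sup>T * inv_mat S * K = P0\<^sup>T * A12 * inv_mat S * A12\<^sup>T * P0"
    using assms(21) by simp
  moreover have "symmetric_mat (K\<^sup>T * inv_mat S * K)"
    using symmetric_mat_congruence[OF K T(1)] symmetric_mat_inverse[OF S T(1) assms(12) T(2,3)] .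
  moreover have "negative_definite_mat (K\<^sup>T * inv_mat S * K)"
    using negative_definite_mat_congruence[OF K T(1) negative_definite_inv_mat[OF S assms(13)] inj] .
  moreover have "n1o \<le> r" using full_column_rank_imp_le[OF rank] K by simp
  moreover have "K\<^sup>T * inv_mat S * K \<in> carrier_mat n1o n1o" using K T(1) by simp
  ultimately show ?thesis using K rank by blast
qed

end
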